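(* Let $n\ge 1$ be an integer, $\delta\in\mathbb R^n$ a vector and $\Lambda$ an $n\times n$ real symmetric matrix. Let $q:\mathbb R^n\to\mathbb R$ be the quadratic function $q(w)=w^\top\Lambda w+w^\top\delta$. The following assertions are equivalent. 1. The function $\mathrm{Inf}[q\mid\sigma]:\mathbb R^n\to\overline{\mathbb R}$, $\mathrm{Inf}[q\mid\sigma](x)=\inf\{w^\top\Lambda w+w^\top\delta: w\in\mathbb R^n,\ w_1^2=x_1,\dots,w_n^2=x_n\}$ is convex. 2. The pair $(\Lambda,\delta)$ can be put in block-signed form. In these two equivalent cases, $\mathrm{Inf}[q\mid\sigma]$ is proper convex lower semicontinuous with effective domain $\mathbb R_+^n$, and it equals the function given by $$x\mapsto\begin{cases}+\infty&\text{if }x\notin\mathbb R_+^n,\\ \sum_{i=1}^n\Lambda_{i,i}x_i-\sum_{i\ne j}|\Lambda_{i,j}|\sqrt{x_ix_j}-\sum_{i=1}^n|\delta_i|\sqrt{x_i}&\text{if }x\in\mathbb R_+^n.\end{cases}$$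
   Context: $\overline{\mathbb R}=[-\infty,+\infty]$ and $\inf\emptyset=+\infty$. Sums over $i\ne j$ range over ordered pairs $(i,j)\in\{1,\dots,n\}^2$ with $i\neq j$. A function with values in $\overline{\mathbb R}$ is convex if its epigraph is convex, proper if it never takes the value $-\infty$ and is not identically $+\infty$; its effective domain is the set where it is $<+\infty$. The square mapping is $\sigma(w)=(w_1^2,\dots,w_n^2)$. Block-signed form: the pair $(\Lambda,\delta)$ can be put in block-signed form if there exist (possibly empty) subsets $P,M\subset\{1,\dots,n\}$ with $P\cap M=\emptyset$, $P\cup M=\{1,\dots,n\}$ such that $\delta_i\ge 0$ for $i\in P$; $\delta_i\le 0$ for $i\in M$; $\Lambda_{i,j}\le 0$ for all $i\neq j$ both in $P$ and for all $i\ne j$ both in $M$; and $\Lambda_{i,j}\ge 0$ whenever one of $i,j$ is in $P$ and the other is in $M$ (diagonal entries are unrestricted). *)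

theory Defs
  imports "HOL-Analysis.Analysis"
begin

definition ereal_epigraph :: "('a \<Rightarrow> ereal) \<Rightarrow> ('a \<times> real) set" where
  "ereal_epigraph f = {(x, t). f x \<le> ereal t}"

definition ereal_convex :: "('a::real_vector \<Rightarrow> ereal) \<Rightarrow> bool" where
  "ereal_convex f \<longleftrightarrow> convex (ereal_epigraph f)"

definition ereal_proper :: "('a \<Rightarrow> ereal) \<Rightarrow> bool" where
  "ereal_proper f \<longleftrightarrow> (\<forall>x. f x \<noteq> -\<infinity>) \<and> (\<exists>x. f x \<noteq> \<infinity>)"

definition effective_domain :: "('a \<Rightarrow> ereal) \<Rightarrow> 'a set" where
  "effective_domain f = {x. f x < \<infinity>}"

(* The punctured limit "at x" suffices here: taking the limit inferior over
   unpunctured neighbourhoods would only add the value f x itself. *)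
definition lower_semicontinuous :: "('a::topological_space \<Rightarrow> ereal) \<Rightarrow> bool" where
  "lower_semicontinuous f \<longleftrightarrow> (\<forall>x. f x \<le> Liminf (at x) f)"

definition Inf_given :: "('a \<Rightarrow> real) \<Rightarrow> ('a \<Rightarrow> 'b) \<Rightarrow> 'b \<Rightarrow> ereal" where
  "Inf_given q g x = (INF w\<in>{w. g w = x}. ereal (q w))"

definition square_map :: "real ^ 'n \<Rightarrow> real ^ 'n" where
  "square_map w = (\<chi> i. (w $ i)\<^sup>2)"

definition quad :: "real ^ 'n ^ 'n \<Rightarrow> real ^ 'n \<Rightarrow> real ^ 'n \<Rightarrow> real" where
  "quad \<Lambda> \<delta> w = w \<bullet> (\<Lambda> *v w) + w \<bullet> \<delta>"

definition block_signed :: "real ^ 'n ^ 'n \<Rightarrow> real ^ 'n \<Rightarrow> bool" where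
  "block_signed \<Lambda> \<delta> \<longleftrightarrow>
    (\<exists>P M. P \<inter> M = {} \<and> P \<union> M = UNIV \<and>
      (\<forall>i\<in>P. \<delta> $ i \<ge> 0) \<and>
      (\<forall>i\<in>M. \<delta> $ i \<le> 0) \<and>
      (\<forall>i\<in>P. \<forall>j\<in>P. i \<noteq> j \<longrightarrow> \<Lambda> $ i $ j \<le> 0) \<and>
      (\<forall>i\<in>M. \<forall>j\<in>M. i \<noteq> j \<longrightarrow> \<Lambda> $ i $ j \<le> 0) \<and>
      (\<forall>i\<in>P. \<forall>j\<in>M. \<Lambda> $ i $ j \<ge> 0 \<and> \<Lambda> $ j $ i \<ge> 0))"

definition nonneg_orthant :: "(real ^ 'n) set" where
  "nonneg_orthant = {x. \<forall>i. 0 \<le> x $ i}"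

definition explicit_form :: "real ^ 'n ^ 'n \<Rightarrow> real ^ 'n \<Rightarrow> real ^ 'n \<Rightarrow> ereal" where
  "explicit_form \<Lambda> \<delta> x =
    (if x \<in> nonneg_orthant
     then ereal ((\<Sum>i\<in>UNIV. \<Lambda> $ i $ i * x $ i)
       - (\<Sum>(i, j)\<in>{(i, j). i \<noteq> j}. \<bar>\<Lambda> $ i $ j\<bar> * sqrt (x $ i * x $ j))
       - (\<Sum>i\<in>UNIV. \<bar>\<delta> $ i\<bar> * sqrt (x $ i)))
     else \<infinity>)"

end

theory Submission
  imports Defs
begin

text \<open>Block-signedness says that suitable signs of the coordinates make every off-diagonal term
  \<open>\<Lambda>\<^sub>i\<^sub>j w\<^sub>i w\<^sub>j\<close> and every linear term \<open>\<delta>\<^sub>i w\<^sub>i\<close> nonpositive at once; the infimum is then the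
  explicit formula, and convexity is the concavity of \<open>\<lambda>(x, y). sqrt (x y)\<close>. For the converse, treat
  \<open>\<delta>\<close> as the row of an extra index, which turns the claim into the existence of signs \<open>\<epsilon>\<close> with
  \<open>A\<^sub>i\<^sub>j \<epsilon>\<^sub>i \<epsilon>\<^sub>j \<le> 0\<close>. Convexity forces the smooth branches of the infimum through two minimizers
  with the same squares to have equal gradients. If signs exist on a set \<open>T\<close> but do not extend to
  \<open>T \<union> {k}\<close>, some connected component \<open>C\<close> of the coupling graph on \<open>T\<close> is coupled to \<open>k\<close> with both
  signs. Choosing \<open>\<bar>w\<bar>\<close> on \<open>T\<close> such that the two kinds of coupling cancel, and \<open>\<bar>w\<^sub>k\<bar>\<close> so small that
  every minimizer is optimal on \<open>T\<close>, flipping the signs on \<open>C\<close> gives a second minimizer whose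
  gradient differs in a coordinate of \<open>C\<close>.\<close>

section \<open>Quadratic forms, finite sign choices and cancelling weights\<close>

definition bilin_sum :: "('a::finite \<Rightarrow> 'a \<Rightarrow> real) \<Rightarrow> ('a \<Rightarrow> real) \<Rightarrow> real" where
  "bilin_sum A w = (\<Sum>i\<in>UNIV. \<Sum>j\<in>UNIV. A i j * w i * w j)"

text \<open>The row and the column of \<open>k\<close> contribute equally by symmetry and its
  diagonal entry is zero. This isolates a term linear in \<open>w k\<close>, which a small
  \<open>w k\<close> turns into a perturbation of the form on \<open>T\<close>.\<close>

lemma bilin_sum_insert_support:
  fixes A :: "'a::finite \<Rightarrow> 'a \<Rightarrow> real"
  assumes sym: "\<And>i j. A i j = A j i" and diag: "\<And>i. A i i = 0"
    and k: "k \<notin> T" and supp: "\<And>j. j \<notin> insert k T \<Longrightarrow> w j = 0"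
  shows "bilin_sum A w =
    (\<Sum>i\<in>T. \<Sum>j\<in>T. A i j * w i * w j) + 2 * w k * (\<Sum>j\<in>T. A k j * w j)"
proof -
  have inner: "(\<Sum>j\<in>UNIV. A i j * w i * w j) = (\<Sum>j\<in>insert k T. A i j * w i * w j)" for i
    by (rule sum.mono_neutral_right) (auto simp: supp)
  have "bilin_sum A w = (\<Sum>i\<in>insert k T. \<Sum>j\<in>insert k T. A i j * w i * w j)"
    unfolding bilin_sum_def inner
    by (rule sum.mono_neutral_right) (auto simp: supp)
  also have "\<dots> = (\<Sum>j\<in>T. A k j * w k * w j)
      + ((\<Sum>i\<in>T. A i k * w i * w k) + (\<Sum>i\<in>T. \<Sum>j\<in>T. A i j * w i * w j))"
    using k by (simp add: diag sum.distrib)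
  also have "(\<Sum>j\<in>T. A k j * w k * w j) = w k * (\<Sum>j\<in>T. A k j * w j)"
    by (simp add: sum_distrib_left mult_ac)
  also have "(\<Sum>i\<in>T. A i k * w i * w k) = w k * (\<Sum>j\<in>T. A k j * w j)"
    by (simp add: sum_distrib_left mult_ac sym[of k])
  finally show ?thesis by (simp add: algebra_simps)
qed

text \<open>Fixed squares leave only finitely many sign choices, so every \<open>Q\<close> attains
  its minimum.\<close>

lemma ex_minimizer_fixed_squares:
  fixes Y :: "'a::finite \<Rightarrow> real" and Q :: "('a \<Rightarrow> real) \<Rightarrow> real"
  obtains w where "\<And>j. (w j)\<^sup>2 = (Y j)\<^sup>2"
    and "\<And>v. (\<And>j. (v j)\<^sup>2 = (Y j)\<^sup>2) \<Longrightarrow> Q w \<le> Q v"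
proof -
  let ?V = "{v. \<forall>j. (v j)\<^sup>2 = (Y j)\<^sup>2}"
  have "?V \<subseteq> PiE UNIV (\<lambda>j. {Y j, - Y j})"
    by (auto simp: power2_eq_iff)
  then have fin: "finite ?V"
    by (rule finite_subset) (intro finite_PiE; simp)
  have "Min (Q ` ?V) \<in> Q ` ?V"
    using fin by (intro Min_in) auto
  then obtain w where w: "w \<in> ?V" "Q w = Min (Q ` ?V)" by auto
  show ?thesis
  proof (rule that)
    show "(w j)\<^sup>2 = (Y j)\<^sup>2" for j using w by auto
    show "Q w \<le> Q v" if "\<And>j. (v j)\<^sup>2 = (Y j)\<^sup>2" for v
      using that fin unfolding w(2) by (intro Min_le) auto
  qed
qed

lemma finite_pos_lower_bound:
  fixes g :: "'a \<Rightarrow> real"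
  assumes "finite S" and "\<And>s. s \<in> S \<Longrightarrow> g s > 0"
  obtains m where "m > 0" and "\<And>s. s \<in> S \<Longrightarrow> m \<le> g s"
proof
  \<comment> \<open>The extra element 1 keeps the minimum defined when \<open>S\<close> is
    empty.\<close>
  show "Min (insert 1 (g ` S)) > 0" using assms by simp
  show "Min (insert 1 (g ` S)) \<le> g s" if "s \<in> S" for s using assms that by simp
qed

text \<open>Indices with positive \<open>h\<close> get the total negative mass as weight, all others
  the total positive mass; the two parts of the sum then cancel. Dividing by the weight of
  \<open>z\<close> normalizes it to 1.\<close>

lemma ex_pos_vanishing_combination:
  fixes h :: "'a \<Rightarrow> real"
  assumes fin: "finite C" and a: "a \<in> C" "h a > 0" and b: "b \<in> C" "h b < 0"
  obtains y where "\<And>j. y j > 0" and "y z = 1" and "(\<Sum>j\<in>C. h j * y j) = 0"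
proof -
  define p where "p = (\<Sum>j\<in>{j\<in>C. h j > 0}. h j)"
  define n where "n = (\<Sum>j\<in>{j\<in>C. \<not> h j > 0}. - h j)"
  define y where "y j = (if h j > 0 then n else p)" for j
  have p: "p > 0" unfolding p_def
    using fin a by (intro sum_pos2[where i = a]) auto
  have n: "n > 0" unfolding n_def
    using fin b by (intro sum_pos2[where i = b]) auto
  have y: "y j > 0" for j using p n by (simp add: y_def)
  have "(\<Sum>j\<in>C. h j * y j) = (\<Sum>j\<in>{j\<in>C. h j > 0}. h j * n) + (\<Sum>j\<in>{j\<in>C. \<not> h j > 0}. h j * p)"
    using fin unfolding y_def
    by (subst sum.If_cases[symmetric, where P = "\<lambda>j. h j > 0", simplified Int_def, simplified])
       (auto intro!: sum.cong)
  also have "\<dots> = n * p - p * n"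
    unfolding sum_distrib_right[symmetric] by (simp add: p_def n_def sum_negf)
  finally have 0: "(\<Sum>j\<in>C. h j * y j) = 0" by simp
  show ?thesis
  proof (rule that)
    show "y j / y z > 0" for j using y by simp
    show "y z / y z = 1" using y[of z] by simp
    show "(\<Sum>j\<in>C. h j * (y j / y z)) = 0" using 0 by (simp flip: sum_divide_distrib)
  qed
qed

section \<open>Extending a sign pattern by one index\<close>

text \<open>For symmetric \<open>A\<close>, \<open>w i * (\<Sum>j\<in>UNIV. A i j * w j)\<close> is
  \<open>x i\<close> times the partial derivative in \<open>x i = (w i)\<^sup>2\<close> of the
  smooth branch through \<open>w\<close>. The coordinate \<open>z\<close> is frozen at
  \<plusminus>1, so nothing is demanded for \<open>i = z\<close>.\<close>

definition agreeing_gradients :: "('a::finite \<Rightarrow> 'a \<Rightarrow> real) \<Rightarrow> 'a \<Rightarrow> bool" where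
  "agreeing_gradients A z \<longleftrightarrow> (\<forall>w w' i. (w z)\<^sup>2 = 1 \<longrightarrow> (\<forall>j. (w' j)\<^sup>2 = (w j)\<^sup>2) \<longrightarrow>
     (\<forall>v. (\<forall>j. (v j)\<^sup>2 = (w j)\<^sup>2) \<longrightarrow> bilin_sum A w \<le> bilin_sum A v) \<longrightarrow>
     bilin_sum A w' = bilin_sum A w \<longrightarrow> i \<noteq> z \<longrightarrow>
     w' i * (\<Sum>j\<in>UNIV. A i j * w' j) = w i * (\<Sum>j\<in>UNIV. A i j * w j))"

text \<open>Signs on \<open>T\<close> may be flipped on whole components of its coupling graph, so
  only a component coupled to \<open>k\<close> with both relative signs can obstruct the extension.
  The new signs need not extend the given ones.\<close>

lemma sign_extension:
  fixes A :: "'a::finite \<Rightarrow> 'a \<Rightarrow> real"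
  assumes sym: "\<And>i j. A i j = A j i" and diag: "\<And>i. A i i = 0"
    and grad: "agreeing_gradients A z"
    and T: "z \<in> T" "k \<notin> T"
    and \<epsilon>: "\<And>i. \<epsilon> i = 1 \<or> \<epsilon> i = - 1" "\<And>i j. i \<in> T \<Longrightarrow> j \<in> T \<Longrightarrow> A i j * \<epsilon> i * \<epsilon> j \<le> 0"
  shows "\<exists>\<eta>. (\<forall>i. \<eta> i = 1 \<or> \<eta> i = - 1) \<and>
    (\<forall>i\<in>insert k T. \<forall>j\<in>insert k T. A i j * \<eta> i * \<eta> j \<le> 0)"
proof (rule ccontr)
  assume none: "\<not> ?thesis"
  \<comment> \<open>\<open>R\<close> holds the couplings inside \<open>T\<close>. A positive
    \<open>h j\<close> asks for the sign -1 at \<open>k\<close>, a negative one for the sign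
    1.\<close>
  define R where "R = {(i, j). i \<in> T \<and> j \<in> T \<and> A i j \<noteq> 0}"
  define h where "h j = A k j * \<epsilon> j" for j
  have symR: "sym (R\<^sup>*)"
    by (rule sym_rtrancl) (auto simp: R_def sym_def sym)
  have "\<exists>a b. a \<in> T \<and> (a, b) \<in> R\<^sup>* \<and> h a > 0 \<and> h b < 0"
  proof (rule ccontr)
    assume nomix: "\<not> ?thesis"
    \<comment> \<open>\<open>B\<close> is the union of the components on which \<open>h\<close> is
      somewhere positive. Without mixing, \<open>h\<close> is nonnegative on \<open>B\<close> and
      nonpositive on the rest of \<open>T\<close>, so flipping \<open>B\<close> and giving
      \<open>k\<close> the sign 1 would work.\<close>
    define B where "B = {j. \<exists>a\<in>T. (j, a) \<in> R\<^sup>* \<and> h a > 0}"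
    define \<eta> where "\<eta> j = (if j = k then 1 else if j \<in> B then - \<epsilon> j else \<epsilon> j)" for j
    have B_edge: "i \<in> B \<longleftrightarrow> j \<in> B" if "(i, j) \<in> R" for i j
    proof -
      have "(j, i) \<in> R" using that by (auto simp: R_def sym)
      with that show ?thesis unfolding B_def
        by (blast intro: converse_rtrancl_into_rtrancl)
    qed
    have 1: "\<eta> i = 1 \<or> \<eta> i = - 1" for i
      using \<epsilon>(1)[of i] by (auto simp: \<eta>_def)
    have 2: "A i j * \<eta> i * \<eta> j \<le> 0" if "i \<in> T" "j \<in> T" for i j
    proof (cases "A i j = 0")
      case False
      then have "(i, j) \<in> R" using that by (simp add: R_def)
      from B_edge[OF this] show ?thesis
        using \<epsilon>(2)[OF that] that T by (auto simp: \<eta>_def)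
    qed simp
    have 3: "A k j * \<eta> j \<le> 0" if "j \<in> T" for j
    proof (cases "j \<in> B")
      case True
      then obtain a where "a \<in> T" "(j, a) \<in> R\<^sup>*" "h a > 0" by (auto simp: B_def)
      then have "\<not> h j < 0" using nomix symD[OF symR] by blast
      then show ?thesis using True that T by (auto simp: \<eta>_def h_def)
    next
      case False
      then have "\<not> h j > 0" using that by (auto simp: B_def)
      then show ?thesis using False that T by (auto simp: \<eta>_def h_def)
    qed
    have "A i j * \<eta> i * \<eta> j \<le> 0" if "i \<in> insert k T" "j \<in> insert k T" for i j
      using that 2[of i j] 3[of i] 3[of j] sym[of i k]
      by (auto simp: diag) (auto simp: \<eta>_def)
    with 1 none show False by blast
  qed
  then obtain a b where a: "a \<in> T" "h a > 0" and ab: "(a, b) \<in> R\<^sup>*" and b: "h b < 0" by auto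
  define C where "C = {j. (a, j) \<in> R\<^sup>*}"
  have aC: "a \<in> C" and bC: "b \<in> C" using ab by (auto simp: C_def)
  have CT: "C \<subseteq> T"
  proof
    fix j assume "j \<in> C"
    then have "(a, j) \<in> R\<^sup>*" by (simp add: C_def)
    then show "j \<in> T" by (induction) (auto simp: a R_def)
  qed
  have kC: "k \<notin> C" using CT T by auto
  have C_edge: "A i j = 0" if "i \<in> C" "j \<in> T - C" for i j
    using that CT by (auto simp: C_def R_def intro: rtrancl_into_rtrancl)
  \<comment> \<open>With these moduli the couplings of \<open>C\<close> to \<open>k\<close> cancel;
    \<open>y z = 1\<close> meets the normalization in \<open>agreeing_gradients\<close>.\<close>
  obtain y where y: "\<And>j. y j > 0" "y z = 1" and y0: "(\<Sum>j\<in>C. h j * y j) = 0"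
    using ex_pos_vanishing_combination[of C a h b z] a aC b bC by auto
  \<comment> \<open>Since every nonzero term has modulus at least \<open>m\<close>, a wrong sign
    costs at least \<open>2 * m\<close>.\<close>
  obtain m where m: "m > 0"
    and m_le: "\<And>i j. A i j \<noteq> 0 \<Longrightarrow> m \<le> \<bar>A i j\<bar> * y i * y j"
  proof (rule finite_pos_lower_bound[of "{(i, j). A i j \<noteq> 0}" "\<lambda>(i, j). \<bar>A i j\<bar> * y i * y j"])
    show "finite {(i, j). A i j \<noteq> 0}" by simp
    show "(case s of (i, j) \<Rightarrow> \<bar>A i j\<bar> * y i * y j) > 0" if "s \<in> {(i, j). A i j \<noteq> 0}" for s
      using that y by auto
  qed (use that in auto)
  define K where "K = (\<Sum>j\<in>T. \<bar>A k j\<bar> * y j)"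
  have K: "K \<ge> 0" unfolding K_def by (intro sum_nonneg mult_nonneg_nonneg) (auto simp: y less_imp_le)
  \<comment> \<open>The modulus at \<open>k\<close> is so small that the terms involving
    \<open>k\<close>, bounded by \<open>2 * \<tau> * K\<close>, stay below \<open>m\<close>. The
    summand 1 covers \<open>K = 0\<close>.\<close>
  define \<tau> where "\<tau> = m / (2 * K + 1)"
  have \<tau>: "\<tau> > 0" "2 * \<tau> * K < m" using m K by (auto simp: \<tau>_def field_simps)
  define Y where "Y j = (if j \<in> T then y j else if j = k then \<tau> else 0)" for j
  define V where "V = {v. \<forall>j. (v j)\<^sup>2 = (Y j)\<^sup>2}"
  have V_iff: "v \<in> V \<longleftrightarrow> (\<forall>j. (v j)\<^sup>2 = (Y j)\<^sup>2)" for v by (simp add: V_def)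
  obtain w where w: "w \<in> V" and w_min: "\<And>v. v \<in> V \<Longrightarrow> bilin_sum A w \<le> bilin_sum A v"
    using ex_minimizer_fixed_squares[of Y "bilin_sum A"] unfolding V_iff by metis
  have supp: "v j = 0" if "v \<in> V" "j \<notin> insert k T" for v j
    using that by (auto simp: V_iff Y_def dest: spec[of _ j])
  have absv: "\<bar>v j\<bar> = y j" if "v \<in> V" "j \<in> T" for v j
  proof -
    have "(v j)\<^sup>2 = (y j)\<^sup>2" using that by (auto simp: V_iff Y_def)
    then show ?thesis using y(1)[of j] by (auto simp: power2_eq_iff)
  qed
  have absk: "\<bar>v k\<bar> = \<tau>" if "v \<in> V" for v
  proof -
    have "(v k)\<^sup>2 = \<tau>\<^sup>2" using that T by (simp add: V_iff Y_def)
    then show ?thesis using \<tau>(1) by (auto simp: power2_eq_iff)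
  qed
  have expand: "bilin_sum A v =
      (\<Sum>i\<in>T. \<Sum>j\<in>T. A i j * v i * v j) + 2 * v k * (\<Sum>j\<in>T. A k j * v j)"
    if "v \<in> V" for v
    using supp[OF that] T by (intro bilin_sum_insert_support sym diag) auto
  have cross: "\<bar>2 * v k * (\<Sum>j\<in>T. A k j * v j)\<bar> < m" if "v \<in> V" for v
  proof -
    have "\<bar>\<Sum>j\<in>T. A k j * v j\<bar> \<le> (\<Sum>j\<in>T. \<bar>A k j * v j\<bar>)" by (rule sum_abs)
    also have "\<dots> = K" unfolding K_def using absv[OF that] by (auto simp: abs_mult intro!: sum.cong)
    finally have "2 * \<tau> * \<bar>\<Sum>j\<in>T. A k j * v j\<bar> \<le> 2 * \<tau> * K" using \<tau> by simp
    with \<tau>(2) have "2 * \<tau> * \<bar>\<Sum>j\<in>T. A k j * v j\<bar> < m" by linarith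
    then show ?thesis by (simp add: abs_mult absk[OF that])
  qed
  \<comment> \<open>The competitor \<open>e\<close> uses the given signs, so each of its terms
    within \<open>T\<close> is as small as its modulus allows.\<close>
  define e where "e j = \<epsilon> j * Y j" for j
  have "(\<epsilon> j)\<^sup>2 = 1" for j using \<epsilon>(1)[of j] by auto
  then have e: "e \<in> V" by (simp add: V_iff e_def power_mult_distrib)
  have e_T: "A i j * e i * e j = - (\<bar>A i j\<bar> * y i * y j)" if "i \<in> T" "j \<in> T" for i j
  proof -
    have "A i j * \<epsilon> i * \<epsilon> j = - \<bar>A i j\<bar>"
      using \<epsilon>(1)[of i] \<epsilon>(1)[of j] \<epsilon>(2)[OF that] by auto
    then have "A i j * \<epsilon> i * \<epsilon> j * (y i * y j) = - \<bar>A i j\<bar> * (y i * y j)" by simp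
    then show ?thesis using that by (simp add: e_def Y_def mult_ac)
  qed
  \<comment> \<open>A wrong sign within \<open>T\<close> makes \<open>w\<close> worse than
    \<open>e\<close> there by at least \<open>2 * m\<close>, while the terms involving
    \<open>k\<close> can win back less than \<open>2 * m\<close>.\<close>
  have w_opt: "A p q * w p * w q \<le> 0" if pq: "p \<in> T" "q \<in> T" for p q
  proof (rule ccontr)
    assume viol: "\<not> ?thesis"
    have lo: "- (\<bar>A i j\<bar> * y i * y j) \<le> A i j * w i * w j" if "i \<in> T" "j \<in> T" for i j
      using absv[OF w that(1)] absv[OF w that(2)] by (metis abs_ge_minus_self abs_mult minus_le_iff)
    have gain: "0 \<le> A i j * w i * w j - A i j * e i * e j" if "i \<in> T" "j \<in> T" for i j
      using lo[OF that] e_T[OF that] by linarith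
    have "2 * m \<le> A p q * w p * w q - A p q * e p * e q"
    proof -
      have "A p q * w p * w q = \<bar>A p q * w p * w q\<bar>" using viol by simp
      also have "\<dots> = \<bar>A p q\<bar> * y p * y q" by (simp add: abs_mult absv[OF w] pq)
      finally have "A p q * w p * w q = \<bar>A p q\<bar> * y p * y q" .
      moreover have "A p q \<noteq> 0" using viol by auto
      ultimately show ?thesis using m_le[of p q] e_T[OF pq] by linarith
    qed
    also have "\<dots> \<le> (\<Sum>j\<in>T. A p j * w p * w j - A p j * e p * e j)"
      by (rule member_le_sum[OF pq(2)]) (auto intro!: gain pq(1) simp del: diff_ge_0_iff_ge)
    also have "\<dots> \<le> (\<Sum>i\<in>T. \<Sum>j\<in>T. A i j * w i * w j - A i j * e i * e j)"
      by (rule member_le_sum[OF pq(1)]) (auto intro!: sum_nonneg gain simp del: diff_ge_0_iff_ge)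
    finally have "2 * m \<le> (\<Sum>i\<in>T. \<Sum>j\<in>T. A i j * w i * w j) - (\<Sum>i\<in>T. \<Sum>j\<in>T. A i j * e i * e j)"
      by (simp add: sum_subtractf)
    moreover have "bilin_sum A w \<le> bilin_sum A e" using e by (rule w_min)
    ultimately show False
      using cross[OF w] cross[OF e] expand[OF w] expand[OF e] by linarith
  qed
  \<comment> \<open>The ratio \<open>w j * \<epsilon> j / y j\<close> is constant on
    \<open>C\<close>: along an edge both \<open>w\<close> and \<epsilon> make the term nonpositive,
    so their relative sign does not change.\<close>
  have sgn_const: "w j * \<epsilon> j * y a = w a * \<epsilon> a * y j" if "j \<in> C" for j
  proof -
    have "(a, j) \<in> R\<^sup>*" using that by (simp add: C_def)
    then show ?thesis
    proof (induction)
      case (step i j)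
      then have ij: "i \<in> T" "j \<in> T" "A i j \<noteq> 0" by (auto simp: R_def)
      have nz: "w i * \<epsilon> i \<noteq> 0" "w j * \<epsilon> j \<noteq> 0"
        using absv[OF w ij(1)] absv[OF w ij(2)] y(1)[of i] y(1)[of j] \<epsilon>(1)[of i] \<epsilon>(1)[of j] by auto
      have "0 \<le> (A i j * w i * w j) * (A i j * \<epsilon> i * \<epsilon> j)"
        using w_opt[OF ij(1,2)] \<epsilon>(2)[OF ij(1,2)] by (rule mult_nonpos_nonpos)
      also have "\<dots> = (A i j)\<^sup>2 * ((w i * \<epsilon> i) * (w j * \<epsilon> j))"
        by (simp add: power2_eq_square mult_ac)
      finally have pos: "(w i * \<epsilon> i) * (w j * \<epsilon> j) \<ge> 0"
        using ij(3) by (simp add: zero_le_mult_iff)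
      have ab: "\<bar>w i * \<epsilon> i\<bar> = y i" "\<bar>w j * \<epsilon> j\<bar> = y j"
        using absv[OF w ij(1)] absv[OF w ij(2)] \<epsilon>(1)[of i] \<epsilon>(1)[of j] by (auto simp: abs_mult)
      have "w j * \<epsilon> j * y i = w i * \<epsilon> i * y j"
        using pos nz ab[symmetric] by (auto simp: zero_le_mult_iff)
      then have "(w j * \<epsilon> j * y a) * y i = (w i * \<epsilon> i * y a) * y j" by (simp add: mult_ac)
      also have "\<dots> = (w a * \<epsilon> a * y j) * y i" using step.IH by (simp add: mult_ac)
      finally show ?case using y(1)[of i] by simp
    qed simp
  qed
  have w_C: "(\<Sum>j\<in>C. A k j * w j) = 0"
  proof -
    have "A k j * w j * y a = w a * \<epsilon> a * (h j * y j)" if "j \<in> C" for j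
    proof -
      have "\<epsilon> j * \<epsilon> j = 1" using \<epsilon>(1)[of j] by auto
      then have "A k j * w j * y a = h j * (w j * \<epsilon> j * y a)" by (simp add: h_def)
      then show ?thesis using sgn_const[OF that] by simp
    qed
    then have "(\<Sum>j\<in>C. A k j * w j) * y a = w a * \<epsilon> a * (\<Sum>j\<in>C. h j * y j)"
      by (simp add: sum_distrib_left sum_distrib_right)
    with y0 y(1)[of a] show ?thesis by simp
  qed
  \<comment> \<open>The flip keeps the form: no coupling within \<open>T\<close> leaves
    \<open>C\<close>, and the contribution of \<open>C\<close> to the row of \<open>k\<close> is
    zero.\<close>
  define w' where "w' j = (if j \<in> C then - w j else w j)" for j
  have w': "w' \<in> V" using w by (simp add: V_iff w'_def)
  have T_inv: "A i j * w' i * w' j = A i j * w i * w j" if "i \<in> T" "j \<in> T" for i j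
    using that C_edge[of i j] C_edge[of j i] sym[of i j] by (auto simp: w'_def)
  have "(\<Sum>j\<in>T. A k j * w j) - (\<Sum>j\<in>T. A k j * w' j) = (\<Sum>j\<in>T. if j \<in> C then 2 * (A k j * w j) else 0)"
    unfolding sum_subtractf[symmetric] by (rule sum.cong) (auto simp: w'_def)
  also have "\<dots> = 2 * (\<Sum>j\<in>C. A k j * w j)"
    using CT by (simp add: sum.inter_restrict[symmetric] Int_absorb1 sum_distrib_left)
  finally have k_inv: "(\<Sum>j\<in>T. A k j * w' j) = (\<Sum>j\<in>T. A k j * w j)" using w_C by simp
  have Q_inv: "bilin_sum A w' = bilin_sum A w"
    unfolding expand[OF w'] expand[OF w] k_inv using kC
    by (simp add: T_inv cong: sum.cong) (simp add: w'_def)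
  have "a \<noteq> b" using a b by auto
  \<comment> \<open>The gradient at \<open>z\<close> is not controlled, but both \<open>a\<close>
    and \<open>b\<close> are coupled to \<open>k\<close> and one of them differs from
    \<open>z\<close>.\<close>
  then obtain c where c: "c \<in> C" "c \<noteq> z" "A k c \<noteq> 0"
    using aC bC a b by (metis h_def less_irrefl mult_zero_left)
  have "w' c * (\<Sum>j\<in>UNIV. A c j * w' j) = w c * (\<Sum>j\<in>UNIV. A c j * w j)"
  proof (rule grad[unfolded agreeing_gradients_def, rule_format])
    show "(w z)\<^sup>2 = 1" using w T y by (simp add: V_iff Y_def)
    show "(w' j)\<^sup>2 = (w j)\<^sup>2" for j using w w' by (simp add: V_iff)
    show "bilin_sum A w \<le> bilin_sum A v" if "\<And>j. (v j)\<^sup>2 = (w j)\<^sup>2" for v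
      using w that by (intro w_min) (simp add: V_iff)
  qed (use Q_inv c in auto)
  \<comment> \<open>In row \<open>c\<close>, terms inside \<open>C\<close> flip twice, those in
    \<open>T - C\<close> have zero coefficient, and \<open>w\<close> vanishes outside
    \<open>insert k T\<close>. Only the term of \<open>k\<close> changes.\<close>
  moreover have "w c * (\<Sum>j\<in>UNIV. A c j * w j) - w' c * (\<Sum>j\<in>UNIV. A c j * w' j)
      = (\<Sum>j\<in>UNIV. if j = k then 2 * A c k * w c * w k else 0)"
    unfolding sum_distrib_left sum_subtractf[symmetric]
  proof (rule sum.cong)
    fix j
    show "w c * (A c j * w j) - w' c * (A c j * w' j) = (if j = k then 2 * A c k * w c * w k else 0)"
      using c kC C_edge[of c j] supp[OF w, of j] by (auto simp: w'_def)
  qed simp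
  ultimately have "A c k * w c * w k = 0" by simp
  moreover have "w c \<noteq> 0" using absv[OF w, of c] y(1)[of c] c CT by auto
  moreover have "w k \<noteq> 0" using absk[OF w] \<tau> by auto
  ultimately show False using c sym[of c k] by simp
qed

text \<open>Indices are added one at a time to \<open>{z}\<close>, where the zero diagonal makes any
  signs admissible.\<close>

lemma sign_pattern_exists:
  fixes A :: "'a::finite \<Rightarrow> 'a \<Rightarrow> real"
  assumes sym: "\<And>i j. A i j = A j i" and diag: "\<And>i. A i i = 0"
    and grad: "agreeing_gradients A z"
  obtains \<epsilon> where "\<And>i. \<epsilon> i = 1 \<or> \<epsilon> i = - 1" "\<And>i j. A i j * \<epsilon> i * \<epsilon> j \<le> 0"
proof -
  have "\<exists>\<epsilon>. (\<forall>i. \<epsilon> i = 1 \<or> \<epsilon> i = - 1) \<and>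
    (\<forall>i\<in>insert z U. \<forall>j\<in>insert z U. A i j * \<epsilon> i * \<epsilon> j \<le> 0)" for U
    using finite[of U]
  proof (induction U)
    case empty
    show ?case by (intro exI[of _ "\<lambda>_. 1"]) (simp add: diag)
  next
    case (insert k U)
    then obtain \<epsilon> where \<epsilon>: "\<And>i. \<epsilon> i = 1 \<or> \<epsilon> i = - 1"
      "\<And>i j. i \<in> insert z U \<Longrightarrow> j \<in> insert z U \<Longrightarrow> A i j * \<epsilon> i * \<epsilon> j \<le> 0" by blast
    show ?case
    proof (cases "k = z")
      case True
      with \<epsilon> show ?thesis by (intro exI[of _ \<epsilon>]) auto
    next
      case False
      with insert have "k \<notin> insert z U" by simp
      from sign_extension[OF sym diag grad insertI1 this \<epsilon>]
      show ?thesis by (simp only: insert_commute[of z k])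
    qed
  qed
  from this[of UNIV] show ?thesis using that by auto
qed

section \<open>First-order consequences of convexity\<close>

text \<open>This is the exact Taylor expansion along a coordinate; symmetry gives the factor 2 in
  the partial derivative.\<close>

lemma quad_add_axis:
  assumes "transpose \<Lambda> = \<Lambda>"
  shows "quad \<Lambda> \<delta> (w + c *\<^sub>R axis i 1) =
    quad \<Lambda> \<delta> w + c * (2 * (\<Lambda> *v w) $ i + \<delta> $ i) + c\<^sup>2 * \<Lambda> $ i $ i"
proof -
  have 1: "w \<bullet> (\<Lambda> *v axis i 1) = (\<Lambda> *v w) $ i"
    using dot_lmul_matrix[of w \<Lambda> "axis i 1"] assms
    by (metis cart_eq_inner_axis vector_transpose_matrix)
  have 2: "(\<Lambda> *v axis i 1) $ i = \<Lambda> $ i $ i"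
    by (simp add: matrix_vector_mult_basis column_def)
  show ?thesis
    unfolding quad_def
    by (simp add: matrix_vector_right_distrib matrix_vector_mult_scaleR inner_add_left
        1 2 inner_axis' power2_eq_square algebra_simps)
qed

lemma quad_sum:
  "quad \<Lambda> \<delta> w = (\<Sum>i\<in>UNIV. \<Sum>j\<in>UNIV. \<Lambda> $ i $ j * (w $ i * w $ j)) + (\<Sum>i\<in>UNIV. \<delta> $ i * w $ i)"
  by (simp add: quad_def inner_vec_def matrix_vector_mult_def sum_distrib_left mult_ac)

lemma Inf_given_le: "Inf_given q g (g w) \<le> ereal (q w)"
  unfolding Inf_given_def by (rule INF_lower) simp

text \<open>The points over \<open>g w1\<close> and \<open>g w2\<close> lie in the epigraph, hence
  so does their midpoint over \<open>g w\<close>, where optimality bounds the infimum below by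
  \<open>q w\<close>.\<close>

lemma ereal_convex_midpoint:
  assumes "ereal_convex (Inf_given q g)"
    and opt: "\<And>v. g v = g w \<Longrightarrow> q w \<le> q v"
    and mid: "g w1 + g w2 = 2 *\<^sub>R g w"
  shows "2 * q w \<le> q w1 + q w2"
proof -
  let ?F = "Inf_given q g"
  have "(1/2) *\<^sub>R (g w1, q w1) + (1/2) *\<^sub>R (g w2, q w2) \<in> ereal_epigraph ?F"
    using assms(1) unfolding ereal_convex_def
    by (rule convexD) (auto simp: ereal_epigraph_def Inf_given_le)
  moreover have "(1/2) *\<^sub>R g w1 + (1/2) *\<^sub>R g w2 = g w"
    unfolding scaleR_add_right[symmetric] mid by simp
  ultimately have "?F (g w) \<le> ereal (q w1 / 2 + q w2 / 2)"
    by (simp add: ereal_epigraph_def)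
  moreover have "ereal (q w) \<le> ?F (g w)"
    unfolding Inf_given_def using opt by (intro INF_greatest) auto
  ultimately have "ereal (q w) \<le> ereal (q w1 / 2 + q w2 / 2)" by (rule order_trans[rotated])
  then show ?thesis by simp
qed

text \<open>The vector on the left is \<open>w\<close> with coordinate \<open>i\<close> scaled by
  \<open>s\<close>; for \<open>s = sqrt (1 + h)\<close> its square moves linearly in
  \<open>h\<close>.\<close>

lemma square_map_add_axis:
  "square_map (w + (w $ i * (s - 1)) *\<^sub>R axis i 1) = square_map w + ((s\<^sup>2 - 1) * (w $ i)\<^sup>2) *\<^sub>R axis i 1"
  by (simp add: square_map_def vec_eq_iff axis_def) (simp add: power2_eq_square algebra_simps)

text \<open>A convex function lying below two smooth functions that touch it at the same point
  forces their gradients there to agree; here the smooth functions are the branches of the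
  infimum through two minimizers of the same fibre.\<close>

lemma minimizers_same_gradient:
  assumes conv: "ereal_convex (Inf_given (quad \<Lambda> \<delta>) square_map)" and tr: "transpose \<Lambda> = \<Lambda>"
    and opt: "\<And>v. square_map v = square_map w \<Longrightarrow> quad \<Lambda> \<delta> w \<le> quad \<Lambda> \<delta> v"
    and w': "square_map w' = square_map w" "quad \<Lambda> \<delta> w' = quad \<Lambda> \<delta> w"
  shows "w' $ i * (2 * (\<Lambda> *v w') $ i + \<delta> $ i) = w $ i * (2 * (\<Lambda> *v w) $ i + \<delta> $ i)"
proof -
  \<comment> \<open>\<beta> is the partial derivative, and \<open>D v s\<close> the increment of
    \<open>quad\<close> when coordinate \<open>i\<close> of \<open>v\<close> is scaled by
    \<open>s\<close>.\<close>
  define \<beta> where "\<beta> v = 2 * (\<Lambda> *v v) $ i + \<delta> $ i" for v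
  define D where "D v s = v $ i * (s - 1) * \<beta> v + (v $ i * (s - 1))\<^sup>2 * \<Lambda> $ i $ i" for v s
  \<comment> \<open>The two branches move the same square by opposite amounts, so their midpoint
    stays over \<open>square_map w\<close>. Convexity makes \<open>f\<close> nonnegative near its
    zero at 0, where its derivative must vanish.\<close>
  define f where "f h = D w (sqrt (1 + h)) + D w' (sqrt (1 - h))" for h
  have f_nonneg: "f h \<ge> 0" if "\<bar>h\<bar> < 1" for h
  proof -
    have sq: "(w' $ i)\<^sup>2 = (w $ i)\<^sup>2" using w'(1) by (simp add: square_map_def vec_eq_iff)
    let ?w1 = "w + (w $ i * (sqrt (1 + h) - 1)) *\<^sub>R axis i 1"
    let ?w2 = "w' + (w' $ i * (sqrt (1 - h) - 1)) *\<^sub>R axis i 1"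
    have "square_map ?w1 + square_map ?w2 = 2 *\<^sub>R square_map w"
      unfolding square_map_add_axis using that
      by (simp add: w'(1) sq scaleR_2)
    then have "2 * quad \<Lambda> \<delta> w \<le> quad \<Lambda> \<delta> ?w1 + quad \<Lambda> \<delta> ?w2"
      using ereal_convex_midpoint[OF conv opt] by blast
    then show ?thesis
      unfolding quad_add_axis[OF tr] by (simp add: f_def D_def \<beta>_def w'(2))
  qed
  have "(f has_real_derivative (w $ i * \<beta> w - w' $ i * \<beta> w') / 2) (at 0)"
    unfolding f_def[abs_def] D_def[abs_def]
    by (auto intro!: derivative_eq_intros simp: field_simps)
  then have "(w $ i * \<beta> w - w' $ i * \<beta> w') / 2 = 0"
  proof (rule DERIV_local_min[where d = 1])
    show "\<forall>y. \<bar>0 - y\<bar> < 1 \<longrightarrow> f 0 \<le> f y"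
      using f_nonneg by (auto simp: f_def D_def)
  qed simp
  then show ?thesis by (simp add: \<beta>_def)
qed

section \<open>Homogenization and the necessity of block signs\<close>

text \<open>The index \<open>None\<close> turns the linear part into couplings, halved because each
  occurs in a row and a column. The diagonal of \<Lambda> is dropped, as it contributes only a
  function of the squares.\<close>

fun homogenized :: "real ^ 'n ^ 'n \<Rightarrow> real ^ 'n \<Rightarrow> 'n option \<Rightarrow> 'n option \<Rightarrow> real" where
  "homogenized \<Lambda> \<delta> None None = 0"
| "homogenized \<Lambda> \<delta> None (Some j) = \<delta> $ j / 2"
| "homogenized \<Lambda> \<delta> (Some i) None = \<delta> $ i / 2"
| "homogenized \<Lambda> \<delta> (Some i) (Some j) = (if i = j then 0 else \<Lambda> $ i $ j)"

lemma sum_UNIV_option: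
  "(\<Sum>x\<in>UNIV. f x) = f None + (\<Sum>i\<in>UNIV. f (Some i))" for f :: "'n::finite option \<Rightarrow> real"
  by (simp add: UNIV_option_conv sum.reindex)

lemma sum_off_diag:
  "(\<Sum>j\<in>UNIV. (if i = j then 0 else c j) * d j) = (\<Sum>j\<in>UNIV. c j * d j) - c i * d i"
  for c d :: "'n::finite \<Rightarrow> real"
proof -
  have "(\<Sum>j\<in>UNIV. (if i = j then 0 else c j) * d j) = (\<Sum>j\<in>UNIV - {i}. c j * d j)"
    by (rule sum.mono_neutral_cong_right) auto
  then show ?thesis by (simp add: sum_diff1)
qed

text \<open>If \<open>W None\<close> is \<plusminus>1, this is the global sign change making that
  coordinate 1, followed by its removal.\<close>

definition dehom :: "('n option \<Rightarrow> real) \<Rightarrow> real ^ 'n" where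
  "dehom W = (\<chi> i. W None * W (Some i))"

text \<open>The correction depends on squares only, so equal gradients for \<open>quad\<close> give
  equal gradients for the homogenized form.\<close>

lemma homogenized_row:
  assumes "(W None)\<^sup>2 = 1"
  shows "2 * (W (Some i) * (\<Sum>x\<in>UNIV. homogenized \<Lambda> \<delta> (Some i) x * W x)) =
    dehom W $ i * (2 * (\<Lambda> *v dehom W) $ i + \<delta> $ i) - 2 * \<Lambda> $ i $ i * (W (Some i))\<^sup>2"
proof -
  have W: "W None * (W None * t) = t" for t
    using assms by (simp add: power2_eq_square flip: mult.assoc)
  have dot: "W None * (\<Lambda> *v dehom W) $ i = (\<Sum>j\<in>UNIV. \<Lambda> $ i $ j * W (Some j))"
    by (simp add: matrix_vector_mult_def dehom_def sum_distrib_left mult.left_commute W)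
  have "(\<Sum>x\<in>UNIV. homogenized \<Lambda> \<delta> (Some i) x * W x)
      = \<delta> $ i / 2 * W None + (W None * (\<Lambda> *v dehom W) $ i - \<Lambda> $ i $ i * W (Some i))"
    unfolding dot by (simp add: sum_UNIV_option sum_off_diag)
  moreover have "dehom W $ i = W None * W (Some i)" by (simp add: dehom_def)
  ultimately show ?thesis by (simp only:) (simp add: field_simps power2_eq_square)
qed

text \<open>Again the correction is constant under sign changes, so minimizers correspond.\<close>

lemma homogenized_form:
  assumes "(W None)\<^sup>2 = 1"
  shows "bilin_sum (homogenized \<Lambda> \<delta>) W = quad \<Lambda> \<delta> (dehom W) - (\<Sum>i\<in>UNIV. \<Lambda> $ i $ i * (W (Some i))\<^sup>2)"
proof -
  have W: "W None * (W None * t) = t" for t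
    using assms by (simp add: power2_eq_square flip: mult.assoc)
  have Q: "quad \<Lambda> \<delta> (dehom W) = (\<Sum>i\<in>UNIV. \<Sum>j\<in>UNIV. \<Lambda> $ i $ j * (W (Some i) * W (Some j)))
      + (\<Sum>i\<in>UNIV. \<delta> $ i * (W None * W (Some i)))"
    unfolding quad_sum by (simp add: dehom_def mult_ac W)
  show ?thesis
    unfolding Q bilin_sum_def
    by (simp add: sum_UNIV_option mult.assoc sum_off_diag sum.distrib sum_subtractf
        power2_eq_square sum_distrib_left flip: sum_divide_distrib)
       (simp add: mult_ac sum_divide_distrib flip: sum.distrib)
qed

lemma convex_imp_block_signed:
  fixes \<Lambda> :: "real ^ 'n ^ 'n"
  assumes tr: "transpose \<Lambda> = \<Lambda>"
    and conv: "ereal_convex (Inf_given (quad \<Lambda> \<delta>) square_map)"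
  shows "block_signed \<Lambda> \<delta>"
proof -
  let ?A = "homogenized \<Lambda> \<delta>"
  have \<Lambda>_sym: "\<Lambda> $ i $ j = \<Lambda> $ j $ i" for i j
    using arg_cong[OF tr, of "\<lambda>M. M $ i $ j"] by (simp add: transpose_def)
  have sym: "?A x y = ?A y x" for x y
    by (cases x; cases y) (auto simp: \<Lambda>_sym)
  have diag: "?A x x = 0" for x
    by (cases x) auto
  have grad: "agreeing_gradients ?A None"
    unfolding agreeing_gradients_def
  proof (intro allI impI)
    fix W W' :: "'n option \<Rightarrow> real" and x :: "'n option"
    assume W: "(W None)\<^sup>2 = 1" and W': "\<forall>y. (W' y)\<^sup>2 = (W y)\<^sup>2"
      and min: "\<forall>V. (\<forall>y. (V y)\<^sup>2 = (W y)\<^sup>2) \<longrightarrow> bilin_sum ?A W \<le> bilin_sum ?A V"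
      and eq: "bilin_sum ?A W' = bilin_sum ?A W" and x: "x \<noteq> None"
    have W'N: "(W' None)\<^sup>2 = 1" using W W' by simp
    obtain i where i: "x = Some i" using x by auto
    have sq: "square_map (dehom V) = (\<chi> i. (V (Some i))\<^sup>2)" if "(V None)\<^sup>2 = 1" for V :: "'n option \<Rightarrow> real"
      using that by (simp add: square_map_def dehom_def power_mult_distrib)
    have opt: "quad \<Lambda> \<delta> (dehom W) \<le> quad \<Lambda> \<delta> v" if "square_map v = square_map (dehom W)" for v
    proof -
      \<comment> \<open>A competitor \<open>v\<close> is lifted with the value 1 at
        \<open>None\<close>, so that minimality of \<open>W\<close> applies to it.\<close>
      define V where "V y = (case y of None \<Rightarrow> 1 | Some i \<Rightarrow> v $ i)" for y
      have V: "(V None)\<^sup>2 = 1" "dehom V = v" by (simp_all add: V_def dehom_def)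
      have Vi: "(V (Some i))\<^sup>2 = (W (Some i))\<^sup>2" for i
        using that unfolding sq[of W, OF W] by (simp add: V_def square_map_def vec_eq_iff)
      then have "(V y)\<^sup>2 = (W y)\<^sup>2" for y
        using V W by (cases y) auto
      then have "bilin_sum ?A W \<le> bilin_sum ?A V" using min by simp
      then show ?thesis by (simp add: homogenized_form W V Vi)
    qed
    have "dehom W' $ i * (2 * (\<Lambda> *v dehom W') $ i + \<delta> $ i) =
        dehom W $ i * (2 * (\<Lambda> *v dehom W) $ i + \<delta> $ i)"
    proof (rule minimizers_same_gradient[OF conv tr opt])
      show "square_map (dehom W') = square_map (dehom W)" by (simp add: sq W W'N W')
      show "quad \<Lambda> \<delta> (dehom W') = quad \<Lambda> \<delta> (dehom W)"
        using eq by (simp add: homogenized_form W W'N W')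
    qed
    then show "W' x * (\<Sum>y\<in>UNIV. ?A x y * W' y) = W x * (\<Sum>y\<in>UNIV. ?A x y * W y)"
      using homogenized_row[of W, OF W, of i \<Lambda> \<delta>] homogenized_row[of W', OF W'N, of i \<Lambda> \<delta>] W'
      by (simp add: i)
  qed
  obtain \<epsilon> where \<epsilon>: "\<And>x. \<epsilon> x = 1 \<or> \<epsilon> x = - 1" and neg: "\<And>x y. ?A x y * \<epsilon> x * \<epsilon> y \<le> 0"
    using sign_pattern_exists[of ?A None, OF sym diag grad] by blast
  \<comment> \<open>A sign opposite to that of \<open>None\<close> forces \<delta> to be
    nonnegative, an equal sign forces it to be nonpositive.\<close>
  define P where "P = {i. \<epsilon> (Some i) \<noteq> \<epsilon> None}"
  have \<delta>s: "\<delta> $ i * \<epsilon> None * \<epsilon> (Some i) \<le> 0" for i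
    using neg[of None "Some i"] by simp
  have \<Lambda>s: "\<Lambda> $ i $ j * \<epsilon> (Some i) * \<epsilon> (Some j) \<le> 0" if "i \<noteq> j" for i j
    using neg[of "Some i" "Some j"] that by simp
  show ?thesis
    unfolding block_signed_def
  proof (rule exI[of _ P], rule exI[of _ "- P"], intro conjI ballI impI)
    fix i assume "i \<in> P" then show "0 \<le> \<delta> $ i"
      using \<delta>s[of i] \<epsilon>[of None] \<epsilon>[of "Some i"] by (auto simp: P_def)
  next
    fix i assume "i \<in> - P" then show "\<delta> $ i \<le> 0"
      using \<delta>s[of i] \<epsilon>[of None] \<epsilon>[of "Some i"] by (auto simp: P_def)
  next
    fix i j assume "i \<in> P" "j \<in> P" "i \<noteq> j" then show "\<Lambda> $ i $ j \<le> 0"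
      using \<Lambda>s[of i j] \<epsilon>[of None] \<epsilon>[of "Some i"] \<epsilon>[of "Some j"] by (auto simp: P_def)
  next
    fix i j assume "i \<in> - P" "j \<in> - P" "i \<noteq> j" then show "\<Lambda> $ i $ j \<le> 0"
      using \<Lambda>s[of i j] \<epsilon>[of None] \<epsilon>[of "Some i"] \<epsilon>[of "Some j"] by (auto simp: P_def)
  next
    fix i j assume ij: "i \<in> P" "j \<in> - P"
    then have "i \<noteq> j" by auto
    with ij show "0 \<le> \<Lambda> $ i $ j"
      using \<Lambda>s[of i j] \<epsilon>[of None] \<epsilon>[of "Some i"] \<epsilon>[of "Some j"] by (auto simp: P_def)
    then show "0 \<le> \<Lambda> $ j $ i" by (simp add: \<Lambda>_sym)
  qed auto
qed

section \<open>The explicit formula under block-signedness\<close>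

text \<open>The finite branch of \<open>explicit_form\<close>, kept real-valued for estimates and
  continuity.\<close>

definition explicit_real :: "real ^ 'n ^ 'n \<Rightarrow> real ^ 'n \<Rightarrow> real ^ 'n \<Rightarrow> real" where
  "explicit_real \<Lambda> \<delta> x = (\<Sum>i\<in>UNIV. \<Lambda> $ i $ i * x $ i)
       - (\<Sum>(i, j)\<in>{(i, j). i \<noteq> j}. \<bar>\<Lambda> $ i $ j\<bar> * sqrt (x $ i * x $ j))
       - (\<Sum>i\<in>UNIV. \<bar>\<delta> $ i\<bar> * sqrt (x $ i))"

lemma explicit_form_eq:
  "explicit_form \<Lambda> \<delta> x = (if x \<in> nonneg_orthant then ereal (explicit_real \<Lambda> \<delta> x) else \<infinity>)"
  by (simp add: explicit_form_def explicit_real_def)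

text \<open>The minus signs match the shape of \<open>explicit_real\<close>, so that the two can be
  compared term by term.\<close>

lemma quad_split_diagonal:
  "quad \<Lambda> \<delta> w = (\<Sum>i\<in>UNIV. \<Lambda> $ i $ i * square_map w $ i)
    - (\<Sum>(i, j)\<in>{(i, j). i \<noteq> j}. - \<Lambda> $ i $ j * (w $ i * w $ j))
    - (\<Sum>i\<in>UNIV. - \<delta> $ i * w $ i)"
proof -
  let ?f = "\<lambda>(i, j). \<Lambda> $ i $ j * (w $ i * w $ j)"
  have "(\<Sum>i\<in>UNIV. \<Sum>j\<in>UNIV. \<Lambda> $ i $ j * (w $ i * w $ j)) = sum ?f UNIV"
    by (simp add: sum.cartesian_product)
  also have "\<dots> = sum ?f {(i, j). i = j} + sum ?f {(i, j). i \<noteq> j}"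
    by (subst sum.union_disjoint[symmetric]) (auto intro!: sum.cong)
  also have "sum ?f {(i, j). i = j} = (\<Sum>i\<in>UNIV. \<Lambda> $ i $ i * square_map w $ i)"
    by (rule sum.reindex_bij_witness[of _ "\<lambda>i. (i, i)" fst])
       (auto simp: square_map_def power2_eq_square)
  finally show ?thesis
    unfolding quad_sum by (simp add: sum_negf case_prod_unfold)
qed

lemma block_signed_signs:
  fixes \<delta> :: "real ^ 'n"
  assumes "block_signed \<Lambda> \<delta>"
  obtains s :: "'n \<Rightarrow> real" where "\<And>i. \<bar>s i\<bar> = 1" "\<And>i. - \<delta> $ i * s i = \<bar>\<delta> $ i\<bar>"
    "\<And>i j. i \<noteq> j \<Longrightarrow> - \<Lambda> $ i $ j * (s i * s j) = \<bar>\<Lambda> $ i $ j\<bar>"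
proof -
  from assms obtain P M where PM: "P \<inter> M = {}" "P \<union> M = UNIV"
    "\<forall>i\<in>P. \<delta> $ i \<ge> 0" "\<forall>i\<in>M. \<delta> $ i \<le> 0"
    "\<forall>i\<in>P. \<forall>j\<in>P. i \<noteq> j \<longrightarrow> \<Lambda> $ i $ j \<le> 0"
    "\<forall>i\<in>M. \<forall>j\<in>M. i \<noteq> j \<longrightarrow> \<Lambda> $ i $ j \<le> 0"
    "\<forall>i\<in>P. \<forall>j\<in>M. \<Lambda> $ i $ j \<ge> 0 \<and> \<Lambda> $ j $ i \<ge> 0"
    unfolding block_signed_def by (elim exE conjE) (rule that)
  \<comment> \<open>Negative on \<open>P\<close> and positive on \<open>M\<close>: every linear and
    off-diagonal term then becomes minus its modulus.\<close>
  define s where "s i = (if i \<in> P then - 1 else 1 :: real)" for i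
  have M: "i \<in> M" if "i \<notin> P" for i using PM(2) that by auto
  show ?thesis
  proof (rule that[of s])
    show "\<bar>s i\<bar> = 1" for i by (simp add: s_def)
    show "- \<delta> $ i * s i = \<bar>\<delta> $ i\<bar>" for i
      using PM(3,4) M[of i] by (auto simp: s_def)
    show "- \<Lambda> $ i $ j * (s i * s j) = \<bar>\<Lambda> $ i $ j\<bar>" if "i \<noteq> j" for i j
      using PM(5-7) M[of i] M[of j] that by (auto simp: s_def)
  qed
qed

lemma explicit_real_le_quad: "explicit_real \<Lambda> \<delta> (square_map w) \<le> quad \<Lambda> \<delta> w"
proof -
  have "- \<Lambda> $ i $ j * (w $ i * w $ j) \<le> \<bar>\<Lambda> $ i $ j\<bar> * sqrt (square_map w $ i * square_map w $ j)" for i j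
  proof -
    have "- \<Lambda> $ i $ j * (w $ i * w $ j) \<le> \<bar>\<Lambda> $ i $ j * (w $ i * w $ j)\<bar>" by simp
    then show ?thesis by (simp add: square_map_def real_sqrt_mult abs_mult)
  qed
  moreover have "- \<delta> $ i * w $ i \<le> \<bar>\<delta> $ i\<bar> * sqrt (square_map w $ i)" for i
  proof -
    have "- \<delta> $ i * w $ i \<le> \<bar>\<delta> $ i * w $ i\<bar>" by simp
    then show ?thesis by (simp add: square_map_def abs_mult)
  qed
  ultimately show ?thesis
    unfolding quad_split_diagonal explicit_real_def
    by (intro diff_mono sum_mono order_refl) auto
qed

text \<open>The termwise lower bound holds on every fibre; the block signs provide one point
  attaining all termwise bounds at once.\<close>

lemma Inf_quad_eq_explicit:
  assumes "block_signed \<Lambda> \<delta>"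
  shows "Inf_given (quad \<Lambda> \<delta>) square_map = explicit_form \<Lambda> \<delta>"
proof
  fix x
  show "Inf_given (quad \<Lambda> \<delta>) square_map x = explicit_form \<Lambda> \<delta> x"
  proof (cases "x \<in> nonneg_orthant")
    case False
    then have "{w. square_map w = x} = {}" by (auto simp: nonneg_orthant_def square_map_def)
    with False show ?thesis
      by (simp add: Inf_given_def explicit_form_eq top_ereal_def)
  next
    case True
    then have x: "x $ i \<ge> 0" for i by (simp add: nonneg_orthant_def)
    obtain s where s: "\<And>i. \<bar>s i\<bar> = 1" "\<And>i. - \<delta> $ i * s i = \<bar>\<delta> $ i\<bar>"
      "\<And>i j. i \<noteq> j \<Longrightarrow> - \<Lambda> $ i $ j * (s i * s j) = \<bar>\<Lambda> $ i $ j\<bar>"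
      using block_signed_signs[OF assms] by blast
    define w where "w = (\<chi> i. s i * sqrt (x $ i))"
    have "(s i)\<^sup>2 = 1" for i using s(1)[of i] by (simp add: power2_eq_1_iff abs_if split: if_splits)
    then have w: "square_map w = x"
      using x by (simp add: w_def square_map_def power_mult_distrib vec_eq_iff)
    have 1: "- \<Lambda> $ i $ j * (w $ i * w $ j) = \<bar>\<Lambda> $ i $ j\<bar> * sqrt (x $ i * x $ j)" if "i \<noteq> j" for i j
      unfolding s(3)[OF that, symmetric] by (simp add: w_def real_sqrt_mult)
    have 2: "- \<delta> $ i * w $ i = \<bar>\<delta> $ i\<bar> * sqrt (x $ i)" for i
      unfolding s(2)[symmetric] by (simp add: w_def)
    have "(\<Sum>(i, j)\<in>{(i, j). i \<noteq> j}. - \<Lambda> $ i $ j * (w $ i * w $ j)) =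
        (\<Sum>(i, j)\<in>{(i, j). i \<noteq> j}. \<bar>\<Lambda> $ i $ j\<bar> * sqrt (x $ i * x $ j))"
      using 1 by (intro sum.cong) auto
    then have "quad \<Lambda> \<delta> w = explicit_real \<Lambda> \<delta> x"
      unfolding quad_split_diagonal explicit_real_def w 2 by simp
    then have "Inf_given (quad \<Lambda> \<delta>) square_map x \<le> explicit_form \<Lambda> \<delta> x"
      using Inf_given_le[of "quad \<Lambda> \<delta>" square_map w] True by (simp add: w explicit_form_eq)
    moreover have "explicit_form \<Lambda> \<delta> x \<le> Inf_given (quad \<Lambda> \<delta>) square_map x"
      unfolding Inf_given_def using True explicit_real_le_quad[of \<Lambda> \<delta>]
      by (intro INF_greatest) (auto simp: explicit_form_eq)
    ultimately show ?thesis by (rule antisym)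
  qed
qed

section \<open>Convexity, semicontinuity and domain of the formula\<close>

text \<open>The squares of the two sides differ by
  \<open>u * v * (sqrt (a * d) - sqrt (b * c))\<^sup>2\<close>.\<close>

lemma sqrt_mult_concave:
  fixes a b c d u v :: real
  assumes "a \<ge> 0" "b \<ge> 0" "c \<ge> 0" "d \<ge> 0" "u \<ge> 0" "v \<ge> 0"
  shows "u * sqrt (a * c) + v * sqrt (b * d) \<le> sqrt ((u * a + v * b) * (u * c + v * d))"
proof (rule real_le_rsqrt)
  have "0 \<le> (sqrt (a * d) - sqrt (b * c))\<^sup>2" by simp
  also have "\<dots> = a * d + b * c - 2 * (sqrt (a * c) * sqrt (b * d))"
    using assms by (simp add: power2_diff real_sqrt_mult power_mult_distrib)
  finally have "0 \<le> u * v * (a * d + b * c - 2 * (sqrt (a * c) * sqrt (b * d)))"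
    using assms by simp
  moreover have "(u * sqrt (a * c) + v * sqrt (b * d))\<^sup>2
      = u\<^sup>2 * (a * c) + v\<^sup>2 * (b * d) + 2 * u * v * (sqrt (a * c) * sqrt (b * d))"
    using assms by (simp add: power2_sum power_mult_distrib)
  ultimately show "(u * sqrt (a * c) + v * sqrt (b * d))\<^sup>2 \<le> (u * a + v * b) * (u * c + v * d)"
    by (simp add: algebra_simps power2_eq_square)
qed

lemma explicit_real_convex:
  assumes x: "x \<in> nonneg_orthant" and y: "y \<in> nonneg_orthant" and uv: "u \<ge> 0" "v \<ge> 0" "u + v = 1"
  shows "explicit_real \<Lambda> \<delta> (u *\<^sub>R x + v *\<^sub>R y) \<le> u * explicit_real \<Lambda> \<delta> x + v * explicit_real \<Lambda> \<delta> y"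
proof -
  let ?z = "u *\<^sub>R x + v *\<^sub>R y"
  have nn: "x $ i \<ge> 0" "y $ i \<ge> 0" for i using x y by (auto simp: nonneg_orthant_def)
  have 1: "u * (\<bar>\<Lambda> $ i $ j\<bar> * sqrt (x $ i * x $ j)) + v * (\<bar>\<Lambda> $ i $ j\<bar> * sqrt (y $ i * y $ j))
      \<le> \<bar>\<Lambda> $ i $ j\<bar> * sqrt (?z $ i * ?z $ j)" for i j
    using mult_left_mono[OF sqrt_mult_concave[of "x $ i" "y $ i" "x $ j" "y $ j" u v], of "\<bar>\<Lambda> $ i $ j\<bar>"]
      nn uv by (simp add: algebra_simps)
  \<comment> \<open>With second arguments 1 and \<open>u + v = 1\<close>, the inequality becomes
    concavity of the square root.\<close>
  have 2: "u * (\<bar>\<delta> $ i\<bar> * sqrt (x $ i)) + v * (\<bar>\<delta> $ i\<bar> * sqrt (y $ i)) \<le> \<bar>\<delta> $ i\<bar> * sqrt (?z $ i)" for i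
    using mult_left_mono[OF sqrt_mult_concave[of "x $ i" "y $ i" 1 1 u v], of "\<bar>\<delta> $ i\<bar>"]
      nn uv by (simp add: algebra_simps)
  have "u * (\<Sum>(i, j)\<in>{(i, j). i \<noteq> j}. \<bar>\<Lambda> $ i $ j\<bar> * sqrt (x $ i * x $ j))
      + v * (\<Sum>(i, j)\<in>{(i, j). i \<noteq> j}. \<bar>\<Lambda> $ i $ j\<bar> * sqrt (y $ i * y $ j))
      \<le> (\<Sum>(i, j)\<in>{(i, j). i \<noteq> j}. \<bar>\<Lambda> $ i $ j\<bar> * sqrt (?z $ i * ?z $ j))"
    unfolding sum_distrib_left sum.distrib[symmetric] using 1 by (intro sum_mono) auto
  moreover have "u * (\<Sum>i\<in>UNIV. \<bar>\<delta> $ i\<bar> * sqrt (x $ i)) + v * (\<Sum>i\<in>UNIV. \<bar>\<delta> $ i\<bar> * sqrt (y $ i))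
      \<le> (\<Sum>i\<in>UNIV. \<bar>\<delta> $ i\<bar> * sqrt (?z $ i))"
    unfolding sum_distrib_left sum.distrib[symmetric] using 2 by (intro sum_mono) auto
  moreover have "(\<Sum>i\<in>UNIV. \<Lambda> $ i $ i * ?z $ i)
      = u * (\<Sum>i\<in>UNIV. \<Lambda> $ i $ i * x $ i) + v * (\<Sum>i\<in>UNIV. \<Lambda> $ i $ i * y $ i)"
    unfolding sum_distrib_left sum.distrib[symmetric] by (intro sum.cong) (auto simp: algebra_simps)
  ultimately show ?thesis
    unfolding explicit_real_def right_diff_distrib by linarith
qed

lemma ereal_convex_explicit_form: "ereal_convex (explicit_form \<Lambda> \<delta>)"
  unfolding ereal_convex_def
proof (rule convexI)
  fix p r :: "(real ^ 'a) \<times> real" and u v :: real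
  assume p: "p \<in> ereal_epigraph (explicit_form \<Lambda> \<delta>)" and r: "r \<in> ereal_epigraph (explicit_form \<Lambda> \<delta>)"
    and uv: "0 \<le> u" "0 \<le> v" "u + v = 1"
  obtain x s y t where [simp]: "p = (x, s)" "r = (y, t)" by (cases p, cases r)
  have x: "x \<in> nonneg_orthant" "explicit_real \<Lambda> \<delta> x \<le> s"
    and y: "y \<in> nonneg_orthant" "explicit_real \<Lambda> \<delta> y \<le> t"
    using p r by (auto simp: ereal_epigraph_def explicit_form_eq split: if_splits)
  have "u *\<^sub>R x + v *\<^sub>R y \<in> nonneg_orthant" using x(1) y(1) uv by (simp add: nonneg_orthant_def)
  moreover have "explicit_real \<Lambda> \<delta> (u *\<^sub>R x + v *\<^sub>R y) \<le> u * s + v * t"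
    using explicit_real_convex[OF x(1) y(1) uv, of \<Lambda> \<delta>] mult_left_mono[OF x(2) uv(1)]
      mult_left_mono[OF y(2) uv(2)] by linarith
  ultimately show "u *\<^sub>R p + v *\<^sub>R r \<in> ereal_epigraph (explicit_form \<Lambda> \<delta>)"
    by (simp add: ereal_epigraph_def explicit_form_eq)
qed

lemma closed_nonneg_orthant: "closed (nonneg_orthant :: (real ^ 'n) set)"
  unfolding nonneg_orthant_def
  by (intro closed_Collect_all closed_Collect_le continuous_intros)

lemma lower_semicontinuous_explicit_form: "lower_semicontinuous (explicit_form \<Lambda> \<delta>)"
  unfolding lower_semicontinuous_def le_Liminf_iff
proof (intro allI impI)
  fix x :: "real ^ 'a" and c assume c: "c < explicit_form \<Lambda> \<delta> x"
  show "\<forall>\<^sub>F y in at x. c < explicit_form \<Lambda> \<delta> y"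
  proof (cases "x \<in> nonneg_orthant")
    case False
    have "\<forall>\<^sub>F y in at x. y \<in> - nonneg_orthant"
      using False closed_nonneg_orthant by (intro eventually_at_in_open') auto
    then show ?thesis
      by (rule eventually_mono) (use c False in \<open>simp add: explicit_form_eq\<close>)
  next
    case True
    \<comment> \<open>\<open>sqrt\<close> is continuous on all reals, so this holds on the boundary
      of the orthant too; outside it the value \<infinity> exceeds any such
      \<open>c\<close>.\<close>
    have "isCont (explicit_real \<Lambda> \<delta>) x"
      unfolding explicit_real_def[abs_def] case_prod_unfold by (intro continuous_intros)
    then have "((\<lambda>y. ereal (explicit_real \<Lambda> \<delta> y)) \<longlongrightarrow> ereal (explicit_real \<Lambda> \<delta> x)) (at x)"
      by (simp add: isCont_def)
    then have "\<forall>\<^sub>F y in at x. c < ereal (explicit_real \<Lambda> \<delta> y)"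
      using c True by (intro order_tendstoD) (auto simp: explicit_form_eq)
    then show ?thesis
      by eventually_elim (use c in \<open>auto simp: explicit_form_eq\<close>)
  qed
qed

lemma effective_domain_explicit_form: "effective_domain (explicit_form \<Lambda> \<delta>) = nonneg_orthant"
  by (auto simp: effective_domain_def explicit_form_eq)

lemma ereal_proper_explicit_form: "ereal_proper (explicit_form \<Lambda> \<delta>)"
proof -
  have "0 \<in> nonneg_orthant" by (simp add: nonneg_orthant_def)
  then show ?thesis by (auto simp: ereal_proper_def explicit_form_eq intro!: exI[of _ 0])
qed

theorem theorem21:
  fixes \<Lambda> :: "real ^ 'n ^ 'n" and \<delta> :: "real ^ 'n"
  assumes "transpose \<Lambda> = \<Lambda>"
  defines "F \<equiv> Inf_given (quad \<Lambda> \<delta>) square_map"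
  shows "(ereal_convex F \<longleftrightarrow> block_signed \<Lambda> \<delta>) \<and>
    (ereal_convex F \<or> block_signed \<Lambda> \<delta> \<longrightarrow>
      ereal_proper F \<and> ereal_convex F \<and> lower_semicontinuous F \<and>
      effective_domain F = nonneg_orthant \<and> F = explicit_form \<Lambda> \<delta>)"
proof -
  have "block_signed \<Lambda> \<delta>" if "ereal_convex F"
    using convex_imp_block_signed assms that by blast
  moreover have "F = explicit_form \<Lambda> \<delta>" if "block_signed \<Lambda> \<delta>"
    unfolding F_def using that by (rule Inf_quad_eq_explicit)
  ultimately show ?thesis
    using ereal_convex_explicit_form ereal_proper_explicit_form
      lower_semicontinuous_explicit_form effective_domain_explicit_form by metis
qed

end
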